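(* Let $\mathcal{X}\subset\mathbb{R}^d$ be a closed convex set, let $r$ be the indicator function of $\mathcal{X}$ ($r=0$ on $\mathcal{X}$ and $r=+\infty$ off $\mathcal{X}$), let $g:\mathbb{R}^d\to\mathbb{R}$ be $\rho$-weakly convex with $\rho>0$, and set $\varphi:=g+r$. Assume (A1), (A2), (A3) stated in the context. Let $x_0\in\mathcal{X}$, fix an integer $T>0$ and a real $\gamma>0$, and let $x_{t^*}$ be the point returned by the stochastic projected subgradient method described in the context with constant steplength $\alpha_t=\alpha=\frac{\gamma}{\sqrt{T+1}}$. Then $$\mathbb{E}\left[\|\nabla\varphi_{1/(2\rho)}(x_{t^*})\|^2\right]\le 2\cdot\frac{\left(\varphi_{1/(2\rho)}(x_0)-\min\varphi\right)+\rho L^2\gamma^2}{\gamma\sqrt{T+1}}.$$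
   Context: Norms are Euclidean. A function $g:\mathbb{R}^d\to\mathbb{R}$ is $\rho$-weakly convex if $x\mapsto g(x)+\frac{\rho}{2}\|x\|^2$ is convex. The subdifferential $\partial g(x)$ is the set of all $v\in\mathbb{R}^d$ with $g(y)\ge g(x)+\langle v,y-x\rangle+o(\|y-x\|)$ as $y\to x$. For $\lambda>0$ the Moreau envelope is $\varphi_\lambda(x):=\min_y\{\varphi(y)+\frac{1}{2\lambda}\|y-x\|^2\}$; for $\lambda<\rho^{-1}$ it is $C^1$ with $\nabla\varphi_\lambda(x)=\lambda^{-1}(x-\mathrm{prox}_{\lambda\varphi}(x))$, where $\mathrm{prox}_{\lambda\varphi}(x)$ is the unique minimizer. $\min\varphi$ denotes the minimum value of $\varphi$, assumed to exist. Stochastic oracle: fix a probability space $(\Omega,\mathcal{F},P)$ and equip $\mathbb{R}^d$ with the Borel $\sigma$-algebra. Assumptions: (A1) It is possible to generate i.i.d. realizations $\xi_0,\xi_1,\ldots\sim P$. (A2) There is an open set $U$ containing $\mathrm{dom}\, r=\mathcal{X}$ and a measurable mapping $G:U\times\Omega\to\mathbb{R}^d$ with $\mathbb{E}_\xi[G(x,\xi)]\in\partial g(x)$ for all $x\in U$. (A3) There is a real $L\ge 0$ such that $\mathbb{E}_\xi[\|G(x,\xi)\|^2]\le L^2$ for all $x\in\mathrm{dom}\, r$. Stochastic projected subgradient method: given $x_0\in\mathcal{X}$ and positive stepsizes $\alpha_t$, for $t=0,\ldots,T$ sample $\xi_t\sim P$ (independently) and set $x_{t+1}=\mathrm{proj}_{\mathcal{X}}(x_t-\alpha_tG(x_t,\xi_t))$,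 where $\mathrm{proj}_{\mathcal{X}}$ is the nearest-point projection. Then sample $t^*\in\{0,\ldots,T\}$, independently of the $\xi_t$, with $\mathbb{P}(t^*=t)=\alpha_t/\sum_{s=0}^T\alpha_s$ (uniform for constant stepsize), and return $x_{t^*}$. The expectation is over all this randomness. *)

theory Defs
  imports "HOL-Probability.Probability" "HOL-Library.Landau_Symbols"
begin

definition weakly_convex :: "real \<Rightarrow> ('a::euclidean_space \<Rightarrow> real) \<Rightarrow> bool" where
  "weakly_convex \<rho> g \<longleftrightarrow> convex_on UNIV (\<lambda>x. g x + \<rho> / 2 * (norm x)\<^sup>2)"

text \<open>Frechet subdifferential; \<open>h\<close> is the error term \<open>o(norm (y - x))\<close>.\<close>

definition subdifferential :: "('a::euclidean_space \<Rightarrow> real) \<Rightarrow> 'a \<Rightarrow> 'a set" where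
  "subdifferential g x =
     {v. \<exists>h. h \<in> o[at x](\<lambda>y. norm (y - x)) \<and>
             (\<forall>\<^sub>F y in at x. g y \<ge> g x + v \<bullet> (y - x) + h y)}"

text \<open>The indicator function of convex analysis, not the \<open>0\<close>/\<open>1\<close>-valued \<^const>\<open>indicator\<close>.\<close>

definition convex_indicator :: "'a set \<Rightarrow> 'a \<Rightarrow> ereal" where
  "convex_indicator X x = (if x \<in> X then 0 else \<infinity>)"

text \<open>The minimum value is rendered as the infimum, which agrees with it whenever a minimizer
  exists. It is converted to a real number, so it is meaningful only when it is finite.\<close>

definition min_value :: "('a \<Rightarrow> ereal) \<Rightarrow> real" where
  "min_value f = real_of_ereal (INF y. f y)"

definition moreau_envelope :: "real \<Rightarrow> ('a::euclidean_space \<Rightarrow> ereal) \<Rightarrow> 'a \<Rightarrow> real" where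
  "moreau_envelope l \<phi> x = min_value (\<lambda>y. \<phi> y + ereal (1 / (2 * l) * (norm (y - x))\<^sup>2))"

definition gradient :: "('a::euclidean_space \<Rightarrow> real) \<Rightarrow> 'a \<Rightarrow> 'a" where
  "gradient f x = (THE D. GDERIV f x :> D)"

primrec proj_subgrad_iterate ::
  "'a::euclidean_space set \<Rightarrow> ('a \<Rightarrow> 'w \<Rightarrow> 'a) \<Rightarrow> (nat \<Rightarrow> real) \<Rightarrow> 'a \<Rightarrow> (nat \<Rightarrow> 'w) \<Rightarrow> nat \<Rightarrow> 'a"
where
  "proj_subgrad_iterate X G \<alpha> x0 s 0 = x0"
| "proj_subgrad_iterate X G \<alpha> x0 s (Suc t) =
     closest_point X (proj_subgrad_iterate X G \<alpha> x0 s t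
       - \<alpha> t *\<^sub>R G (proj_subgrad_iterate X G \<alpha> x0 s t) (s t))"

text \<open>On the probability space \<open>M\<close>, the samples \<open>\<xi> 0, \<dots>, \<xi> T\<close> are i.i.d. with law \<open>P\<close>.\<close>

definition iid_samples ::
  "'m measure \<Rightarrow> 'w measure \<Rightarrow> nat \<Rightarrow> (nat \<Rightarrow> 'm \<Rightarrow> 'w) \<Rightarrow> bool" where
  "iid_samples M P T \<xi> \<longleftrightarrow>
     prob_space.indep_vars M (\<lambda>_. P) \<xi> {0..T} \<and> (\<forall>t\<in>{0..T}. distr M P (\<xi> t) = P)"

text \<open>The random output index: independence from the samples is independence of the two generated
  sigma-algebras (\<open>indep_var\<close> would require both variables to have the same value type).\<close>

definition output_index ::
  "'m measure \<Rightarrow> 'w measure \<Rightarrow> nat \<Rightarrow> (nat \<Rightarrow> real) \<Rightarrow> (nat \<Rightarrow> 'm \<Rightarrow> 'w) \<Rightarrow> ('m \<Rightarrow> nat) \<Rightarrow> bool"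
where
  "output_index M P T \<alpha> \<xi> \<tau> \<longleftrightarrow>
     \<tau> \<in> measurable M (count_space {0..T}) \<and>
     (\<forall>t\<in>{0..T}. measure M {w \<in> space M. \<tau> w = t} = \<alpha> t / (\<Sum>s=0..T. \<alpha> s)) \<and>
     prob_space.indep_set M
       (sets (vimage_algebra (space M) \<tau> (count_space {0..T})))
       (sets (vimage_algebra (space M) (\<lambda>w. \<lambda>t\<in>{0..T}. \<xi> t w) (PiM {0..T} (\<lambda>_. P))))"

end

theory Submission
  imports Defs
begin

text \<open>
  The Moreau envelope of \<open>\<phi>\<close> serves as a Lyapunov function. Write \<open>\<kappa>\<close> for the inverse smoothing
  parameter, which is \<open>2 * \<rho>\<close> in the theorem, \<open>e\<close> for the envelope and \<open>p\<close> for the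
  proximal point of \<open>x\<close>. As \<open>\<kappa> > \<rho>\<close>, the function \<open>y \<mapsto> g y + \<kappa> / 2 * norm (y - x)\<^sup>2\<close> is strongly
  convex with constant \<open>\<kappa> - \<rho>\<close>. Hence \<open>p\<close> exists, it depends on \<open>x\<close> in a Lipschitz way
  (\<open>prox_lipschitz\<close>), and \<open>e\<close> is differentiable with gradient \<open>\<kappa> (x - p)\<close>
  (\<open>envelope_GDERIV\<close>). A large gradient therefore means that \<open>x\<close> is far from \<open>p\<close>.

  Consider one step from \<open>x\<close> with stepsize \<open>a\<close>. The projection is nonexpansive and fixes \<open>p\<close>,
  so using \<open>p\<close> as a competitor at the new point bounds the new envelope value by
  \<open>e x + \<kappa> * a * ((p - x) \<bullet> G) + \<kappa> / 2 * a\<^sup>2 * norm G\<^sup>2\<close> (\<open>envelope_after_step\<close>). In expectation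
  \<open>G\<close> is a subgradient \<open>v\<close>, and weak convexity together with the growth of the proximal problem
  gives \<open>v \<bullet> (p - x) \<le> - (\<kappa> - \<rho>) * norm (x - p)\<^sup>2\<close> (\<open>prox_angle\<close>). So the expected envelope
  drops by at least \<open>a * (\<kappa> - \<rho>) / \<kappa>\<close> times the squared gradient, up to the noise term
  \<open>\<kappa> / 2 * a\<^sup>2 * L\<^sup>2\<close> (\<open>expected_descent\<close>).

  Each sample is independent of the iterate it is applied to, so this inequality may be integrated
  and summed along the iteration (\<open>envelope_descent_telescoped\<close>). The envelope never falls below the minimum of
  \<open>\<phi>\<close>, which bounds the stepsize-weighted sum of the expected squared gradients. By independence
  of the output index, that sum divided by the total stepsize is the expected squared gradient at
  the output (\<open>output_index_expectation\<close>, \<open>expected_sq_gradient_at_output\<close>). With constant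
  stepsize the squared stepsizes add up to \<open>\<gamma>\<^sup>2\<close> and the stepsizes to \<open>\<gamma> * sqrt (T + 1)\<close>.
\<close>

section \<open>Weakly convex functions\<close>

text \<open>Convexity of \<open>g + c / 2 * norm\<^sup>2\<close> on a segment, with the square expanded: the identity
  \<open>(1 - t) * norm x\<^sup>2 + t * norm y\<^sup>2 - norm (x + t (y - x))\<^sup>2 = t * (1 - t) * norm (y - x)\<^sup>2\<close>
  turns the quadratic into an error term. For negative \<open>c\<close> the same inequality is strong
  convexity.\<close>
lemma weakly_convex_segment:
  fixes g :: "'a::euclidean_space \<Rightarrow> real"
  assumes "weakly_convex c g" "0 \<le> t" "t \<le> 1"
  shows "g (x + t *\<^sub>R (y - x)) \<le> (1 - t) * g x + t * g y + c / 2 * (t * (1 - t) * (norm (y - x))\<^sup>2)"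
proof -
  have eq: "(1 - t) *\<^sub>R x + t *\<^sub>R y = x + t *\<^sub>R (y - x)"
    by (simp add: algebra_simps)
  have "g (x + t *\<^sub>R (y - x)) + c / 2 * (norm (x + t *\<^sub>R (y - x)))\<^sup>2
      \<le> (1 - t) * (g x + c / 2 * (norm x)\<^sup>2) + t * (g y + c / 2 * (norm y)\<^sup>2)"
    using convex_onD[OF assms(1)[unfolded weakly_convex_def] assms(2,3), of x y]
    unfolding eq by simp
  moreover have "(1 - t) * (norm x)\<^sup>2 + t * (norm y)\<^sup>2 - (norm (x + t *\<^sub>R (y - x)))\<^sup>2
      = t * (1 - t) * (norm (y - x))\<^sup>2"
    unfolding power2_norm_eq_inner
    by (simp add: inner_simps inner_commute algebra_simps)
  then have "c / 2 * ((1 - t) * (norm x)\<^sup>2 + t * (norm y)\<^sup>2 - (norm (x + t *\<^sub>R (y - x)))\<^sup>2)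
      = c / 2 * (t * (1 - t) * (norm (y - x))\<^sup>2)" by simp
  ultimately show ?thesis by (simp add: algebra_simps) argo
qed

lemma weakly_convex_continuous:
  fixes g :: "'a::euclidean_space \<Rightarrow> real"
  assumes "weakly_convex c g"
  shows "continuous_on S g"
proof -
  have "continuous_on UNIV (\<lambda>x. g x + c / 2 * (norm x)\<^sup>2)"
    using assms unfolding weakly_convex_def by (intro convex_on_continuous) auto
  then have "continuous_on UNIV (\<lambda>x. g x + c / 2 * (norm x)\<^sup>2 - c / 2 * (norm x)\<^sup>2)"
    by (rule continuous_on_diff) (intro continuous_intros)
  then have "continuous_on UNIV g" by simp
  then show ?thesis by (rule continuous_on_subset) simp
qed

text \<open>The difference between \<open>k / 2 * norm (y - x)\<^sup>2\<close> and \<open>k / 2 * norm y\<^sup>2\<close> is affine in \<open>y\<close>, so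
  a quadratic penalty lowers the weak convexity constant by \<open>k\<close> wherever it is centred. For
  \<open>k > c\<close> the result is strongly convex.\<close>
lemma weakly_convex_add_square_dist:
  fixes g :: "'a::euclidean_space \<Rightarrow> real"
  assumes "weakly_convex c g"
  shows "weakly_convex (c - k) (\<lambda>y. g y + k / 2 * (norm (y - x))\<^sup>2)"
proof -
  have eq: "g y + k / 2 * (norm (y - x))\<^sup>2 + (c - k) / 2 * (norm y)\<^sup>2
      = (g y + c / 2 * (norm y)\<^sup>2) + (k / 2 * (norm x)\<^sup>2 - k * (y \<bullet> x))" for y
    unfolding power2_norm_eq_inner
    by (simp add: inner_simps inner_commute algebra_simps add_divide_distrib diff_divide_distrib)
  have "convex_on UNIV (\<lambda>y::'a. k / 2 * (norm x)\<^sup>2 - k * (y \<bullet> x))"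
    by (rule convex_onI) (auto simp: inner_simps algebra_simps add_divide_distrib diff_divide_distrib)
  then show ?thesis
    using convex_on_add[OF assms[unfolded weakly_convex_def]] unfolding weakly_convex_def eq by blast
qed

text \<open>Quadratic growth of a strongly convex function away from its minimizer: comparing \<open>f p\<close> with
  the value of \<open>f\<close> at a point of the segment from \<open>p\<close> to \<open>y\<close> gives the claim with the factor
  \<open>1 - t\<close>, which tends to \<open>1\<close> as that point approaches \<open>p\<close>.\<close>
lemma weakly_convex_minimizer_growth:
  fixes f :: "'a::euclidean_space \<Rightarrow> real"
  assumes f: "weakly_convex (- c) f" and "0 \<le> c" and "convex X" "p \<in> X" "y \<in> X"
    and min: "\<And>z. z \<in> X \<Longrightarrow> f p \<le> f z"
  shows "f p + c / 2 * (norm (y - p))\<^sup>2 \<le> f y"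
proof -
  have bound: "f p + c / 2 * ((1 - t) * (norm (y - p))\<^sup>2) \<le> f y" if t: "0 < t" "t < 1" for t
  proof -
    have "p + t *\<^sub>R (y - p) = (1 - t) *\<^sub>R p + t *\<^sub>R y" by (simp add: algebra_simps)
    then have "p + t *\<^sub>R (y - p) \<in> X"
      using convexD[OF \<open>convex X\<close> \<open>p \<in> X\<close> \<open>y \<in> X\<close>, of "1 - t" t] t by simp
    then have "f p \<le> f (p + t *\<^sub>R (y - p))" by (rule min)
    also have "\<dots> \<le> (1 - t) * f p + t * f y + (- c) / 2 * (t * (1 - t) * (norm (y - p))\<^sup>2)"
      using weakly_convex_segment[OF f] t by simp
    finally have "t * (f p + c / 2 * ((1 - t) * (norm (y - p))\<^sup>2)) \<le> t * f y"
      by (simp add: algebra_simps)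
    then show ?thesis using t by simp
  qed
  have "((\<lambda>t. f p + c / 2 * ((1 - t) * (norm (y - p))\<^sup>2))
      \<longlongrightarrow> f p + c / 2 * ((1 - 0) * (norm (y - p))\<^sup>2)) (at_right 0)"
    by (intro tendsto_intros)
  moreover have "\<forall>\<^sub>F t in at_right 0. f p + c / 2 * ((1 - t) * (norm (y - p))\<^sup>2) \<le> f y"
    unfolding eventually_at_right_field using bound by (intro exI[of _ 1]) auto
  ultimately show ?thesis
    using tendsto_upperbound[of _ _ "at_right (0::real)" "f y"] by fastforce
qed

text \<open>A Frechet subgradient is a local first-order object, but weak convexity makes it global:
  the subgradient inequality and the chord bound of weak convexity enclose the increment
  \<open>g (x + t (y - x)) - g x\<close>, and after division by a small \<open>t\<close> the error term of the former is
  below an arbitrary \<open>e > 0\<close>.\<close>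
lemma weakly_convex_subgradient_inequality:
  fixes g :: "'a::euclidean_space \<Rightarrow> real"
  assumes g: "weakly_convex \<rho> g" and "0 \<le> \<rho>" and v: "v \<in> subdifferential g x"
  shows "g x + v \<bullet> (y - x) - \<rho> / 2 * (norm (y - x))\<^sup>2 \<le> g y"
proof (cases "y = x")
  case False
  define d where "d = y - x"
  have d: "norm d > 0" using False by (simp add: d_def)
  obtain h where h: "h \<in> o[at x](\<lambda>y. norm (y - x))"
    and ev: "\<forall>\<^sub>F y in at x. g y \<ge> g x + v \<bullet> (y - x) + h y"
    using v by (auto simp: subdifferential_def)
  have lim: "filterlim (\<lambda>t. x + t *\<^sub>R d) (at x) (at_right 0)"
  proof (rule filterlim_atI)
    have "((\<lambda>t. x + t *\<^sub>R d) \<longlongrightarrow> x + 0 *\<^sub>R d) (at_right 0)"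
      by (intro tendsto_intros)
    then show "((\<lambda>t. x + t *\<^sub>R d) \<longlongrightarrow> x) (at_right 0)" by simp
    show "\<forall>\<^sub>F t in at_right 0. x + t *\<^sub>R d \<noteq> x"
      unfolding eventually_at_right_field using d by (intro exI[of _ 1]) auto
  qed
  have "g x + v \<bullet> d - \<rho> / 2 * (norm d)\<^sup>2 \<le> g y + e" if "e > 0" for e
  proof -
    \<comment> \<open>With this constant the Landau error at \<open>x + t d\<close> is at most \<open>t * e\<close>.\<close>
    define c where "c = e / norm d"
    have c: "c > 0" using that d by (simp add: c_def)
    have "\<forall>\<^sub>F y in at x. norm (h y) \<le> c * norm (norm (y - x))"
      using h c by (rule landau_o.smallD)
    then have "\<forall>\<^sub>F t in at_right 0. norm (h (x + t *\<^sub>R d)) \<le> c * norm (norm (x + t *\<^sub>R d - x))"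
      using lim by (rule eventually_compose_filterlim)
    moreover have "\<forall>\<^sub>F t in at_right 0.
        g (x + t *\<^sub>R d) \<ge> g x + v \<bullet> (x + t *\<^sub>R d - x) + h (x + t *\<^sub>R d)"
      using ev lim by (rule eventually_compose_filterlim)
    moreover have "\<forall>\<^sub>F t in at_right 0. 0 < t \<and> t < (1::real)"
      unfolding eventually_at_right_field by (intro exI[of _ 1]) auto
    ultimately have "\<forall>\<^sub>F t in at_right (0::real). g x + v \<bullet> d - \<rho> / 2 * (norm d)\<^sup>2 \<le> g y + e"
    proof eventually_elim
      case (elim t)
      then have t: "0 < t" "t < 1" by auto
      have "h (x + t *\<^sub>R d) \<ge> - (c * (t * norm d))"
        using elim(1) t by (simp add: abs_le_iff)
      also have "c * (t * norm d) = t * e" using d by (simp add: c_def)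
      finally have "g (x + t *\<^sub>R d) \<ge> g x + t * (v \<bullet> d) - t * e"
        using elim(2) by simp
      moreover have "g (x + t *\<^sub>R d) \<le> (1 - t) * g x + t * g y + \<rho> / 2 * (t * (1 - t) * (norm d)\<^sup>2)"
        using weakly_convex_segment[OF g, of t x y] t by (simp add: d_def)
      moreover have "\<rho> / 2 * (t * (1 - t) * (norm d)\<^sup>2) \<le> \<rho> / 2 * (t * 1 * (norm d)\<^sup>2)"
        using t \<open>0 \<le> \<rho>\<close> by (intro mult_left_mono mult_right_mono) auto
      ultimately have "t * (g x + v \<bullet> d - \<rho> / 2 * (norm d)\<^sup>2) \<le> t * (g y + e)"
        by (simp add: algebra_simps)
      then show ?case using t by simp
    qed
    then show ?thesis by simp
  qed
  then show ?thesis unfolding d_def by (rule field_le_epsilon)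
qed simp

section \<open>Minimum values and gradients\<close>

lemma min_value_eq:
  fixes f :: "'a \<Rightarrow> ereal"
  assumes "f p = ereal c" "\<And>y. f p \<le> f y"
  shows "min_value f = c"
proof -
  have "(INF y. f y) = f p"
    by (rule antisym) (auto intro: INF_lower INF_greatest assms(2))
  then show ?thesis by (simp add: min_value_def assms(1))
qed

text \<open>Identifies the definite description in \<^const>\<open>gradient\<close>, by uniqueness of the derivative.\<close>
lemma gradient_eq:
  assumes "GDERIV f x :> D"
  shows "gradient f x = D"
  unfolding gradient_def
proof (rule the_equality)
  show "GDERIV f x :> D" by (rule assms)
next
  fix D' assume "GDERIV f x :> D'"
  then have "(\<lambda>h. h \<bullet> D') = (\<lambda>h. h \<bullet> D)"
    using assms unfolding gderiv_def by (rule has_derivative_unique)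
  then have "(D' - D) \<bullet> D' = (D' - D) \<bullet> D" by meson
  then have "(D' - D) \<bullet> (D' - D) = 0" by (simp add: inner_diff_right)
  then show "D' = D" by simp
qed

section \<open>Proximal points and the Moreau envelope\<close>

text \<open>The setting for a Moreau envelope of \<open>g\<close> restricted to \<open>X\<close>, with the inverse smoothing
  parameter \<open>\<kappa>\<close>, that is \<open>\<lambda> = 1 / \<kappa>\<close>; the condition \<open>\<rho> < \<kappa>\<close> makes the proximal problem strongly
  convex. The constant \<open>m\<close> stands for any lower bound of \<open>g\<close> on \<open>X\<close>. It makes the proximal
  problem coercive, and it makes the potential \<open>envelope x - m\<close> nonnegative.\<close>
locale constrained_weakly_convex =
  fixes X :: "'a::euclidean_space set" and g :: "'a \<Rightarrow> real" and \<rho> \<kappa> m :: real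
  assumes closed_X: "closed X" and convex_X: "convex X" and X_nonempty: "X \<noteq> {}"
    and rho_nonneg: "0 \<le> \<rho>" and rho_less_kappa: "\<rho> < \<kappa>"
    and weakly_convex_g: "weakly_convex \<rho> g"
    and lower_bound: "\<And>y. y \<in> X \<Longrightarrow> m \<le> g y"
begin

lemma kappa_pos: "0 < \<kappa>"
  using rho_nonneg rho_less_kappa by simp

definition penalized :: "'a \<Rightarrow> 'a \<Rightarrow> real" where
  "penalized x y = g y + \<kappa> / 2 * (norm (y - x))\<^sup>2"

definition prox :: "'a \<Rightarrow> 'a" where
  "prox x = (SOME p. p \<in> X \<and> (\<forall>y\<in>X. penalized x p \<le> penalized x y))"

definition envelope :: "'a \<Rightarrow> real" where
  "envelope x = penalized x (prox x)"

text \<open>The lower bound on \<open>g\<close> confines the sublevel set of any feasible point \<open>a\<close> to a ball around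
  \<open>x\<close>, so that the problem is one of minimizing a continuous function over a compact set.\<close>
lemma penalized_minimizer_exists: "\<exists>p\<in>X. \<forall>y\<in>X. penalized x p \<le> penalized x y"
proof -
  obtain a where a: "a \<in> X" using X_nonempty by blast
  define R where "R = sqrt (2 / \<kappa> * (penalized x a - m))"
  have le: "m \<le> penalized x a"
    using lower_bound[OF a] kappa_pos unfolding penalized_def by (simp add: add_increasing2)
  have sublevel: "norm (y - x) \<le> R" if "y \<in> X" "penalized x y \<le> penalized x a" for y
  proof -
    have "\<kappa> / 2 * (norm (y - x))\<^sup>2 \<le> penalized x a - m"
      using that lower_bound[OF that(1)] unfolding penalized_def by simp
    then have "(norm (y - x))\<^sup>2 \<le> 2 / \<kappa> * (penalized x a - m)"
      using kappa_pos by (simp add: field_simps)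
    then show ?thesis unfolding R_def by (rule real_le_rsqrt)
  qed
  have "compact (X \<inter> cball x R)"
    using closed_X by (intro closed_Int_compact) auto
  moreover have "a \<in> X \<inter> cball x R"
    using sublevel[OF a] a by (simp add: dist_norm norm_minus_commute)
  moreover have "continuous_on (X \<inter> cball x R) (penalized x)"
    unfolding penalized_def
    by (intro continuous_intros weakly_convex_continuous[OF weakly_convex_g])
  ultimately obtain p where p: "p \<in> X \<inter> cball x R"
    "\<forall>y\<in>X \<inter> cball x R. penalized x p \<le> penalized x y"
    using continuous_attains_inf[of "X \<inter> cball x R" "penalized x"] by blast
  have "penalized x p \<le> penalized x y" if "y \<in> X" for y
  proof (cases "penalized x y \<le> penalized x a")
    case True
    then have "y \<in> X \<inter> cball x R"
      using sublevel[OF that] that by (simp add: dist_norm norm_minus_commute)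
    then show ?thesis using p by blast
  next
    case False
    then show ?thesis using p(2)[rule_format, OF \<open>a \<in> X \<inter> cball x R\<close>] by simp
  qed
  then show ?thesis using p(1) by blast
qed

lemma prox_in_X: "prox x \<in> X"
  and prox_minimizes: "y \<in> X \<Longrightarrow> penalized x (prox x) \<le> penalized x y"
  using someI_ex[of "\<lambda>p. p \<in> X \<and> (\<forall>y\<in>X. penalized x p \<le> penalized x y)"]
    penalized_minimizer_exists[of x] unfolding prox_def by blast+

lemma envelope_le: "y \<in> X \<Longrightarrow> envelope x \<le> penalized x y"
  unfolding envelope_def by (rule prox_minimizes)

lemma envelope_ge: "m \<le> envelope x"
  using lower_bound[OF prox_in_X[of x]] kappa_pos
  unfolding envelope_def penalized_def by (simp add: add_increasing2)

lemma penalized_growth: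
  assumes "y \<in> X"
  shows "envelope x + (\<kappa> - \<rho>) / 2 * (norm (y - prox x))\<^sup>2 \<le> penalized x y"
  unfolding envelope_def
proof (rule weakly_convex_minimizer_growth[OF _ _ convex_X prox_in_X assms])
  show "weakly_convex (- (\<kappa> - \<rho>)) (penalized x)"
    using weakly_convex_add_square_dist[OF weakly_convex_g, of \<kappa> x]
    unfolding penalized_def by simp
qed (use rho_less_kappa prox_minimizes in auto)

text \<open>Moving the centre changes the penalty by an expression that depends on \<open>y\<close> only through a
  linear term. Everything about the dependence of the envelope on \<open>x\<close> comes from this identity.\<close>
lemma penalized_shift:
  "penalized x' y = penalized x y + \<kappa> * ((x - y) \<bullet> (x' - x)) + \<kappa> / 2 * (norm (x' - x))\<^sup>2"
  unfolding penalized_def power2_norm_eq_inner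
  by (simp add: inner_simps inner_commute algebra_simps add_divide_distrib diff_divide_distrib)

text \<open>Each of the two proximal problems grows quadratically away from its minimizer; this is tested
  at the minimizer of the other one. When the two growth inequalities are added, the values of \<open>g\<close> cancel and only the inner product of
  \<open>prox x' - prox x\<close> with \<open>x' - x\<close> is left.\<close>
lemma prox_lipschitz: "(\<kappa> - \<rho>) * norm (prox x' - prox x) \<le> \<kappa> * norm (x' - x)"
proof -
  let ?D = "prox x' - prox x"
  have "penalized x (prox x) + (\<kappa> - \<rho>) / 2 * (norm ?D)\<^sup>2 \<le> penalized x (prox x')"
    using penalized_growth[OF prox_in_X[of x'], of x] by (simp add: envelope_def)
  moreover have "penalized x' (prox x') + (\<kappa> - \<rho>) / 2 * (norm ?D)\<^sup>2 \<le> penalized x' (prox x)"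
    using penalized_growth[OF prox_in_X[of x], of x']
    by (simp add: envelope_def norm_minus_commute)
  ultimately have "(\<kappa> - \<rho>) * (norm ?D)\<^sup>2 \<le> \<kappa> * ((x - prox x) \<bullet> (x' - x)) - \<kappa> * ((x - prox x') \<bullet> (x' - x))"
    unfolding penalized_shift[of x' _ x] by (simp add: field_simps)
  also have "\<dots> = \<kappa> * (?D \<bullet> (x' - x))" by (simp add: inner_simps algebra_simps)
  also have "\<dots> \<le> \<kappa> * (norm ?D * norm (x' - x))"
    using kappa_pos by (intro mult_left_mono norm_cauchy_schwarz) auto
  finally have "norm ?D * ((\<kappa> - \<rho>) * norm ?D) \<le> norm ?D * (\<kappa> * norm (x' - x))"
    by (simp add: power2_eq_square algebra_simps)
  then show ?thesis
    using kappa_pos by (cases "norm ?D = 0") (auto simp: mult_le_cancel_left_pos)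
qed

text \<open>The proximal point of \<open>x\<close> is a competitor in the problem at \<open>x'\<close>.\<close>
lemma envelope_upper:
  "envelope x' \<le> envelope x + \<kappa> * ((x - prox x) \<bullet> (x' - x)) + \<kappa> / 2 * (norm (x' - x))\<^sup>2"
  using envelope_le[OF prox_in_X[of x], of x'] unfolding penalized_shift[of x' _ x] envelope_def by simp

text \<open>The proximal point of \<open>x'\<close> is a competitor in the problem at \<open>x\<close>; this yields a bound whose
  linear term involves \<open>prox x'\<close>. Lipschitz continuity replaces it by \<open>prox x\<close> at a
  second-order cost.\<close>
lemma envelope_lower:
  "envelope x + \<kappa> * ((x - prox x) \<bullet> (x' - x)) - \<kappa> * \<kappa> / (\<kappa> - \<rho>) * (norm (x' - x))\<^sup>2 \<le> envelope x'"
proof -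
  have "norm (prox x' - prox x) \<le> \<kappa> / (\<kappa> - \<rho>) * norm (x' - x)"
    using prox_lipschitz[of x' x] rho_less_kappa by (simp add: field_simps)
  then have "norm (prox x' - prox x) * norm (x' - x) \<le> \<kappa> / (\<kappa> - \<rho>) * norm (x' - x) * norm (x' - x)"
    by (rule mult_right_mono) simp
  moreover have "(prox x' - prox x) \<bullet> (x' - x) \<le> norm (prox x' - prox x) * norm (x' - x)"
    by (rule norm_cauchy_schwarz)
  ultimately have "(prox x' - prox x) \<bullet> (x' - x) \<le> \<kappa> / (\<kappa> - \<rho>) * (norm (x' - x))\<^sup>2"
    by (simp add: power2_eq_square)
  then have "\<kappa> * ((prox x' - prox x) \<bullet> (x' - x)) \<le> \<kappa> * (\<kappa> / (\<kappa> - \<rho>) * (norm (x' - x))\<^sup>2)"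
    using kappa_pos by (intro mult_left_mono) auto
  moreover have "envelope x \<le> penalized x (prox x')" by (rule envelope_le[OF prox_in_X])
  moreover have "0 \<le> \<kappa> / 2 * (norm (x' - x))\<^sup>2" using kappa_pos by simp
  ultimately show ?thesis
    unfolding envelope_def[of x'] penalized_shift[of x' _ x]
    by (simp add: inner_simps algebra_simps)
qed

text \<open>The upper and the lower bound have the same affine part, with error \<open>O(norm (y - x)\<^sup>2)\<close>.\<close>
lemma envelope_GDERIV: "GDERIV envelope x :> \<kappa> *\<^sub>R (x - prox x)"
  unfolding gderiv_def has_derivative_at_within
proof
  show "bounded_linear (\<lambda>h. h \<bullet> \<kappa> *\<^sub>R (x - prox x))" by (rule bounded_linear_inner_left)
  define C where "C = \<kappa> / 2 + \<kappa> * \<kappa> / (\<kappa> - \<rho>)"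
  let ?q = "\<lambda>y. (envelope y - envelope x - (y - x) \<bullet> \<kappa> *\<^sub>R (x - prox x)) /\<^sub>R norm (y - x)"
  have bound: "norm (?q y) \<le> C * norm (y - x)" for y
  proof -
    have C: "0 \<le> \<kappa> / 2 * (norm (y - x))\<^sup>2" "0 \<le> \<kappa> * \<kappa> / (\<kappa> - \<rho>) * (norm (y - x))\<^sup>2"
      using kappa_pos rho_less_kappa by auto
    have "\<bar>envelope y - envelope x - (y - x) \<bullet> \<kappa> *\<^sub>R (x - prox x)\<bar> \<le> C * (norm (y - x))\<^sup>2"
      using envelope_upper[of y x] envelope_lower[of x y] C unfolding C_def abs_le_iff
      by (simp add: inner_commute distrib_right)
    then show ?thesis
      by (cases "y = x") (auto simp: power2_eq_square field_simps abs_mult)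
  qed
  have "((\<lambda>y. C * norm (y - x)) \<longlongrightarrow> C * norm (x - x)) (at x)" by (intro tendsto_intros)
  then have "((\<lambda>y. C * norm (y - x)) \<longlongrightarrow> 0) (at x)" by simp
  then show "(?q \<longlongrightarrow> 0) (at x)"
    by (rule Lim_null_comparison[rotated]) (simp only: bound eventually_True)
qed

lemma moreau_envelope_eq:
  assumes "\<phi> = (\<lambda>x. ereal (g x) + convex_indicator X x)"
  shows "moreau_envelope (1 / \<kappa>) \<phi> = envelope"
proof
  fix x
  have k: "1 / (2 * (1 / \<kappa>)) = \<kappa> / 2" by simp
  have val: "\<phi> y + ereal (\<kappa> / 2 * (norm (y - x))\<^sup>2)
      = (if y \<in> X then ereal (penalized x y) else \<infinity>)" for y
    by (simp add: assms convex_indicator_def penalized_def)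
  show "moreau_envelope (1 / \<kappa>) \<phi> x = envelope x"
    unfolding moreau_envelope_def k val
    by (rule min_value_eq[where p = "prox x"])
      (auto simp: prox_in_X envelope_def prox_minimizes)
qed

lemma gradient_envelope: "gradient envelope x = \<kappa> *\<^sub>R (x - prox x)"
  by (rule gradient_eq[OF envelope_GDERIV])

lemma continuous_envelope: "continuous_on S envelope"
  using envelope_GDERIV unfolding gderiv_def
  by (intro continuous_at_imp_continuous_on ballI) (rule has_derivative_continuous)

lemma continuous_prox: "continuous_on S prox"
proof (rule lipschitz_on_continuous_on)
  show "(\<kappa> / (\<kappa> - \<rho>))-lipschitz_on S prox"
    using prox_lipschitz kappa_pos rho_less_kappa
    by (intro lipschitz_onI) (auto simp: dist_norm field_simps)
qed

text \<open>Why an expected subgradient step approaches the proximal point: the subgradient inequality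
  compares \<open>g x\<close> with \<open>g (prox x)\<close> up to \<open>\<rho> / 2\<close>, growth of the proximal problem supplies
  \<open>\<kappa> / 2\<close> and \<open>(\<kappa> - \<rho>) / 2\<close> in the opposite direction, and the values of \<open>g\<close> cancel.\<close>
lemma prox_angle:
  assumes "x \<in> X" "v \<in> subdifferential g x"
  shows "v \<bullet> (prox x - x) \<le> - (\<kappa> - \<rho>) * (norm (x - prox x))\<^sup>2"
proof -
  have "g x + v \<bullet> (prox x - x) - \<rho> / 2 * (norm (prox x - x))\<^sup>2 \<le> g (prox x)"
    by (rule weakly_convex_subgradient_inequality[OF weakly_convex_g rho_nonneg assms(2)])
  moreover have "g (prox x) + \<kappa> / 2 * (norm (prox x - x))\<^sup>2 + (\<kappa> - \<rho>) / 2 * (norm (x - prox x))\<^sup>2 \<le> g x"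
    using penalized_growth[OF assms(1), of x] unfolding envelope_def penalized_def by simp
  ultimately show ?thesis
    by (simp add: norm_minus_commute[of "prox x"] algebra_simps diff_divide_distrib)
qed

end

section \<open>Independent random variables and the random output index\<close>

lemma proj_subgrad_iterate_cong:
  assumes "\<And>i. i < t \<Longrightarrow> s i = s' i"
  shows "proj_subgrad_iterate X G \<alpha> x0 s t = proj_subgrad_iterate X G \<alpha> x0 s' t"
  using assms by (induction t) auto

context prob_space
begin

text \<open>Freezing one of two independent variables. The inner integral ranges over \<open>M\<close> itself rather
  than over the law of \<open>Z\<close>, so that it can be rewritten along any function of \<open>Z\<close>.\<close>
lemma nn_integral_indep_pair:
  assumes indep: "indep_var S Y N Z" and f: "f \<in> borel_measurable (S \<Otimes>\<^sub>M N)"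
  shows "(\<integral>\<^sup>+w. f (Y w, Z w) \<partial>M) = (\<integral>\<^sup>+w. (\<integral>\<^sup>+w'. f (Y w, Z w') \<partial>M) \<partial>M)"
proof -
  have Y: "random_variable S Y" and Z: "random_variable N Z"
    and eq: "distr M S Y \<Otimes>\<^sub>M distr M N Z = distr M (S \<Otimes>\<^sub>M N) (\<lambda>w. (Y w, Z w))"
    using indep unfolding indep_var_distribution_eq by blast+
  interpret Z: prob_space "distr M N Z" using Z by (rule prob_space_distr)
  have f': "f \<in> borel_measurable (distr M S Y \<Otimes>\<^sub>M distr M N Z)"
    using f by (simp cong: measurable_cong_sets)
  have inner: "(\<lambda>y. \<integral>\<^sup>+z. f (y, z) \<partial>distr M N Z) \<in> borel_measurable (distr M S Y)"
    by (rule Z.borel_measurable_nn_integral_fst[OF f'])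
  have "(\<integral>\<^sup>+w. f (Y w, Z w) \<partial>M) = (\<integral>\<^sup>+u. f u \<partial>distr M (S \<Otimes>\<^sub>M N) (\<lambda>w. (Y w, Z w)))"
    using Y Z f by (subst nn_integral_distr) auto
  also have "\<dots> = (\<integral>\<^sup>+y. (\<integral>\<^sup>+z. f (y, z) \<partial>distr M N Z) \<partial>distr M S Y)"
    unfolding eq[symmetric] by (rule Z.nn_integral_fst[OF f', symmetric])
  also have "\<dots> = (\<integral>\<^sup>+w. (\<integral>\<^sup>+z. f (Y w, z) \<partial>distr M N Z) \<partial>M)"
    using Y inner by (subst nn_integral_distr) auto
  also have "\<dots> = (\<integral>\<^sup>+w. (\<integral>\<^sup>+w'. f (Y w, Z w') \<partial>M) \<partial>M)"
    using measurable_space[OF Y] Z f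
    by (intro nn_integral_cong) (auto intro!: nn_integral_distr measurable_Pair2)
  finally show ?thesis .
qed

text \<open>Independence of generated sigma-algebras passes to functions of the two variables. The
  variables \<open>f\<close> and \<open>h\<close> may have different value types, whereas \<^const>\<open>indep_var\<close> relates only
  variables of one type; their images under \<open>Y\<close> and \<open>Z\<close> share a type.\<close>
lemma indep_var_of_generated:
  assumes indep: "indep_set (sets (vimage_algebra (space M) f S)) (sets (vimage_algebra (space M) h N))"
    and f: "random_variable S f" and h: "random_variable N h"
    and Y: "Y \<in> measurable S S'" and Z: "Z \<in> measurable N N'"
  shows "indep_var S' (\<lambda>w. Y (f w)) N' (\<lambda>w. Z (h w))"
proof -
  have gen: "sigma_sets (space M) {(\<lambda>w. Q (q w)) -` A \<inter> space M | A. A \<in> sets K'}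
      \<subseteq> sets (vimage_algebra (space M) q K)"
    if q: "random_variable K q" and Q: "Q \<in> measurable K K'" for q Q and K :: "'x measure" and K' :: "'y measure"
  proof -
    let ?V = "vimage_algebra (space M) q K"
    have "q \<in> measurable ?V K"
      using measurable_space[OF q] by (intro measurable_vimage_algebra1) auto
    then have "(\<lambda>w. Q (q w)) \<in> measurable ?V K'"
      using Q by (rule measurable_compose)
    then have "{(\<lambda>w. Q (q w)) -` A \<inter> space M | A. A \<in> sets K'} \<subseteq> sets ?V"
      by (auto dest: measurable_sets)
    then show ?thesis using sets.sigma_sets_subset[of _ ?V] by simp
  qed
  show ?thesis
    unfolding indep_var_eq
  proof (intro conjI)
    show "indep_set (sigma_sets (space M) {(\<lambda>w. Y (f w)) -` A \<inter> space M |A. A \<in> sets S'})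
        (sigma_sets (space M) {(\<lambda>w. Z (h w)) -` A \<inter> space M |A. A \<in> sets N'})"
      using indep unfolding indep_set_def
      by (rule indep_sets_mono_sets) (use gen[OF f Y] gen[OF h Z] in \<open>auto split: bool.split\<close>)
  qed (use f h Y Z in measurable)
qed

text \<open>Split the integrand along the events \<open>\<tau> = t\<close>: on each of them the indicator is independent of
  the samples, so the expectation factors, and the weights \<open>\<alpha> t / sum \<alpha> {0..T}\<close> are the
  probabilities of these events.\<close>
lemma output_index_expectation:
  fixes F :: "nat \<Rightarrow> (nat \<Rightarrow> 'w) \<Rightarrow> real"
  assumes out: "output_index M P T \<alpha> \<xi> \<tau>"
    and xi: "\<And>t. t \<le> T \<Longrightarrow> random_variable P (\<xi> t)"
    and F: "\<And>t. t \<le> T \<Longrightarrow> F t \<in> borel_measurable (PiM {0..T} (\<lambda>_. P))"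
    and int: "\<And>t. t \<le> T \<Longrightarrow> integrable M (\<lambda>w. F t (\<lambda>i\<in>{0..T}. \<xi> i w))"
  shows "integrable M (\<lambda>w. F (\<tau> w) (\<lambda>i\<in>{0..T}. \<xi> i w))"
    and "(\<integral>w. F (\<tau> w) (\<lambda>i\<in>{0..T}. \<xi> i w) \<partial>M)
      = (\<Sum>t=0..T. \<alpha> t * (\<integral>w. F t (\<lambda>i\<in>{0..T}. \<xi> i w) \<partial>M)) / (\<Sum>t=0..T. \<alpha> t)"
proof -
  let ?\<Xi> = "\<lambda>w. \<lambda>i\<in>{0..T}. \<xi> i w"
  let ?A = "\<lambda>t. {w \<in> space M. \<tau> w = t}"
  have tau: "\<tau> \<in> measurable M (count_space {0..T})"
    and prob: "\<And>t. t \<in> {0..T} \<Longrightarrow> prob (?A t) = \<alpha> t / (\<Sum>s=0..T. \<alpha> s)"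
    and indep: "indep_set (sets (vimage_algebra (space M) \<tau> (count_space {0..T})))
       (sets (vimage_algebra (space M) ?\<Xi> (PiM {0..T} (\<lambda>_. P))))"
    using out unfolding output_index_def by auto
  have Xi: "random_variable (PiM {0..T} (\<lambda>_. P)) ?\<Xi>"
    using xi by (intro measurable_restrict) auto
  have A: "?A t \<in> events" if "t \<in> {0..T}" for t
  proof -
    have "\<tau> -` {t} \<inter> space M \<in> events" using tau that by (intro measurable_sets) auto
    moreover have "\<tau> -` {t} \<inter> space M = ?A t" by auto
    ultimately show ?thesis by simp
  qed
  have pair: "integrable M (\<lambda>w. indicator {t} (\<tau> w) * F t (?\<Xi> w))
      \<and> (\<integral>w. indicator {t} (\<tau> w) * F t (?\<Xi> w) \<partial>M) = \<alpha> t / (\<Sum>s=0..T. \<alpha> s) * (\<integral>w. F t (?\<Xi> w) \<partial>M)"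
    if t: "t \<in> {0..T}" for t
  proof -
    have iv: "indep_var borel (\<lambda>w. indicator {t} (\<tau> w) :: real) borel (\<lambda>w. F t (?\<Xi> w))"
      using t by (intro indep_var_of_generated[OF indep tau Xi]) (auto intro: F)
    have ind: "(indicator {t} (\<tau> w) :: real) = indicator (?A t) w" if "w \<in> space M" for w
      using that by (simp add: indicator_def)
    have int_A: "integrable M (indicator (?A t) :: _ \<Rightarrow> real)"
      using A[OF t] by (simp add: integrable_indicator_iff emeasure_eq_measure)
    have i: "integrable M (\<lambda>w. indicator {t} (\<tau> w) :: real)"
      using int_A by (subst Bochner_Integration.integrable_cong[OF refl ind])
    have "(\<integral>w. (indicator {t} (\<tau> w) :: real) \<partial>M) = (\<integral>w. indicator (?A t) w \<partial>M)"
      by (intro Bochner_Integration.integral_cong refl ind)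
    also have "\<dots> = prob (?A t)" using A[OF t] sets.sets_into_space by (simp add: Int_absorb2)
    finally have "(\<integral>w. (indicator {t} (\<tau> w) :: real) \<partial>M) = \<alpha> t / (\<Sum>s=0..T. \<alpha> s)"
      using prob[OF t] by simp
    moreover have "integrable M (\<lambda>w. F t (?\<Xi> w))" using int t by simp
    ultimately show ?thesis
      using indep_var_lebesgue_integral[OF iv i] indep_var_integrable[OF iv i] by simp
  qed
  have split: "F (\<tau> w) (?\<Xi> w) = (\<Sum>t=0..T. indicator {t} (\<tau> w) * F t (?\<Xi> w))" if "w \<in> space M" for w
  proof -
    have "\<tau> w \<in> {0..T}" using measurable_space[OF tau that] by simp
    then have "(\<Sum>t=0..T. indicator {t} (\<tau> w) * F t (?\<Xi> w)) = (\<Sum>t\<in>{\<tau> w}. indicator {t} (\<tau> w) * F t (?\<Xi> w))"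
      by (intro sum.mono_neutral_right) (auto simp: indicator_def)
    then show ?thesis by simp
  qed
  show "integrable M (\<lambda>w. F (\<tau> w) (?\<Xi> w))"
  proof (subst Bochner_Integration.integrable_cong[OF refl split])
    show "integrable M (\<lambda>w. \<Sum>t=0..T. indicator {t} (\<tau> w) * F t (?\<Xi> w))"
      using pair by (intro Bochner_Integration.integrable_sum) blast
  qed
  have "(\<integral>w. F (\<tau> w) (?\<Xi> w) \<partial>M) = (\<integral>w. (\<Sum>t=0..T. indicator {t} (\<tau> w) * F t (?\<Xi> w)) \<partial>M)"
    by (intro Bochner_Integration.integral_cong refl split)
  also have "\<dots> = (\<Sum>t=0..T. \<integral>w. indicator {t} (\<tau> w) * F t (?\<Xi> w) \<partial>M)"
    using pair by (intro Bochner_Integration.integral_sum) blast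
  also have "\<dots> = (\<Sum>t=0..T. \<alpha> t * (\<integral>w. F t (?\<Xi> w) \<partial>M) / (\<Sum>t=0..T. \<alpha> t))"
    using pair by (intro sum.cong) auto
  finally show "(\<integral>w. F (\<tau> w) (?\<Xi> w) \<partial>M) = (\<Sum>t=0..T. \<alpha> t * (\<integral>w. F t (?\<Xi> w) \<partial>M)) / (\<Sum>t=0..T. \<alpha> t)"
    by (simp add: sum_divide_distrib)
qed

end

section \<open>The stochastic subgradient step\<close>

locale stochastic_subgradient_oracle =
  constrained_weakly_convex X g \<rho> \<kappa> m + sample: prob_space P
  for X :: "'a::euclidean_space set" and g \<rho> \<kappa> m and P :: "'w measure" +
  fixes U :: "'a set" and G :: "'a \<Rightarrow> 'w \<Rightarrow> 'a" and L :: real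
  assumes X_subset_U: "X \<subseteq> U"
    and G_measurable: "case_prod G \<in> borel_measurable (restrict_space borel U \<Otimes>\<^sub>M P)"
    and G_integrable: "\<And>x. x \<in> U \<Longrightarrow> integrable P (G x)"
    and G_unbiased: "\<And>x. x \<in> U \<Longrightarrow> (\<integral>w. G x w \<partial>P) \<in> subdifferential g x"
    and G_second_moment: "\<And>x. x \<in> X \<Longrightarrow> (\<integral>\<^sup>+w. ennreal ((norm (G x w))\<^sup>2) \<partial>P) \<le> ennreal (L\<^sup>2)"
begin

lemma second_moment_integral:
  assumes "x \<in> X"
  shows "integrable P (\<lambda>w. (norm (G x w))\<^sup>2)" "(\<integral>w. (norm (G x w))\<^sup>2 \<partial>P) \<le> L\<^sup>2"
proof -
  have meas: "G x \<in> borel_measurable P" 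
    by (intro borel_measurable_integrable G_integrable subsetD[OF X_subset_U] assms)
  show int: "integrable P (\<lambda>w. (norm (G x w))\<^sup>2)"
  proof (rule integrableI_nonneg)
    show "(\<integral>\<^sup>+w. ennreal ((norm (G x w))\<^sup>2) \<partial>P) < \<infinity>"
      using G_second_moment[OF assms] by (rule le_less_trans) simp
  qed (use meas in auto)
  have "ennreal (\<integral>w. (norm (G x w))\<^sup>2 \<partial>P) = (\<integral>\<^sup>+w. ennreal ((norm (G x w))\<^sup>2) \<partial>P)"
    using int by (intro nn_integral_eq_integral[symmetric]) auto
  also note G_second_moment[OF assms]
  finally show "(\<integral>w. (norm (G x w))\<^sup>2 \<partial>P) \<le> L\<^sup>2"
    by (subst (asm) ennreal_le_iff) auto
qed

text \<open>Since \<open>prox x\<close> lies in \<open>X\<close>, it is a competitor in the proximal problem at the new point, and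
  projecting onto \<open>X\<close> does not increase the distance to it. The remaining penalty at the
  unprojected point is expanded around \<open>x\<close>.\<close>
lemma envelope_after_step:
  "envelope (closest_point X (x - a *\<^sub>R d))
    \<le> envelope x + \<kappa> * a * ((prox x - x) \<bullet> d) + \<kappa> / 2 * a\<^sup>2 * (norm d)\<^sup>2"
proof -
  let ?y = "closest_point X (x - a *\<^sub>R d)"
  have "closest_point X (prox x) = prox x" by (rule closest_point_self[OF prox_in_X])
  then have "norm (prox x - ?y) \<le> norm (prox x - (x - a *\<^sub>R d))"
    using closest_point_lipschitz[OF convex_X closed_X X_nonempty, of "prox x" "x - a *\<^sub>R d"]
    by (simp add: dist_norm)
  then have "\<kappa> / 2 * (norm (prox x - ?y))\<^sup>2 \<le> \<kappa> / 2 * (norm (prox x - (x - a *\<^sub>R d)))\<^sup>2"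
    using kappa_pos by (intro mult_left_mono power_mono) auto
  then have "penalized ?y (prox x) \<le> penalized (x - a *\<^sub>R d) (prox x)"
    unfolding penalized_def by simp
  also have "\<dots> = envelope x + \<kappa> * a * ((prox x - x) \<bullet> d) + \<kappa> / 2 * a\<^sup>2 * (norm d)\<^sup>2"
    unfolding penalized_shift[of "x - a *\<^sub>R d" _ x] envelope_def
    by (simp add: inner_simps algebra_simps power_mult_distrib)
  finally show ?thesis using envelope_le[OF prox_in_X[of x], of ?y] by simp
qed

text \<open>When expectations are taken in the bound on the envelope after a step from a deterministic
  point, the linear term is controlled by the angle between the mean direction and
  \<open>prox x - x\<close>, the quadratic term by the second moment. The inequality is stated for nonnegative integrals, in which form the expectations of
  the potential along the iteration exist without an integrability argument.\<close>
lemma expected_descent: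
  assumes x: "x \<in> X" and a: "0 \<le> a"
  shows "(\<integral>\<^sup>+w. ennreal (envelope (closest_point X (x - a *\<^sub>R G x w)) - m) \<partial>P)
      + ennreal (a * (\<kappa> - \<rho>) / \<kappa> * (norm (gradient envelope x))\<^sup>2)
      \<le> ennreal (envelope x - m) + ennreal (\<kappa> / 2 * L\<^sup>2 * a\<^sup>2)"
proof -
  \<comment> \<open>The upper bound on the potential after the step. Unlike the potential itself, it is an explicit
    integrable function of the oracle output.\<close>
  define R where "R w = envelope x + \<kappa> * a * ((prox x - x) \<bullet> G x w) + \<kappa> / 2 * a\<^sup>2 * (norm (G x w))\<^sup>2 - m" for w
  have xU: "x \<in> U" using x X_subset_U by blast
  have le_R: "envelope (closest_point X (x - a *\<^sub>R G x w)) - m \<le> R w" for w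
    unfolding R_def using envelope_after_step[of x a "G x w"] by linarith
  have R_nonneg: "0 \<le> R w" for w
    using le_R[of w] envelope_ge[of "closest_point X (x - a *\<^sub>R G x w)"] by linarith
  have R_int: "integrable P R"
    unfolding R_def using G_integrable[OF xU] second_moment_integral(1)[OF x] by simp
  have "(\<integral>w. R w \<partial>P) = envelope x + \<kappa> * a * ((prox x - x) \<bullet> (\<integral>w. G x w \<partial>P))
      + \<kappa> / 2 * a\<^sup>2 * (\<integral>w. (norm (G x w))\<^sup>2 \<partial>P) - m"
    unfolding R_def using G_integrable[OF xU] second_moment_integral(1)[OF x]
    by (simp add: sample.prob_space)
  moreover have "\<kappa> * a * ((prox x - x) \<bullet> (\<integral>w. G x w \<partial>P))
      \<le> \<kappa> * a * (- (\<kappa> - \<rho>) * (norm (x - prox x))\<^sup>2)"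
    using prox_angle[OF x G_unbiased[OF xU]] kappa_pos a
    by (intro mult_left_mono) (auto simp: inner_commute)
  moreover have "\<kappa> / 2 * a\<^sup>2 * (\<integral>w. (norm (G x w))\<^sup>2 \<partial>P) \<le> \<kappa> / 2 * a\<^sup>2 * L\<^sup>2"
    using second_moment_integral(2)[OF x] kappa_pos by (intro mult_left_mono) auto
  moreover have "a * (\<kappa> - \<rho>) / \<kappa> * (norm (gradient envelope x))\<^sup>2
      = \<kappa> * a * ((\<kappa> - \<rho>) * (norm (x - prox x))\<^sup>2)"
    using kappa_pos by (simp add: gradient_envelope power_mult_distrib power2_eq_square)
  ultimately have bound: "(\<integral>w. R w \<partial>P) + a * (\<kappa> - \<rho>) / \<kappa> * (norm (gradient envelope x))\<^sup>2
      \<le> (envelope x - m) + \<kappa> / 2 * L\<^sup>2 * a\<^sup>2"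
    by (simp add: algebra_simps)
  have "(\<integral>\<^sup>+w. ennreal (envelope (closest_point X (x - a *\<^sub>R G x w)) - m) \<partial>P) \<le> (\<integral>\<^sup>+w. ennreal (R w) \<partial>P)"
    by (intro nn_integral_mono ennreal_leI le_R)
  also have "\<dots> = ennreal (\<integral>w. R w \<partial>P)"
    using R_int R_nonneg by (intro nn_integral_eq_integral) auto
  finally have "(\<integral>\<^sup>+w. ennreal (envelope (closest_point X (x - a *\<^sub>R G x w)) - m) \<partial>P)
      + ennreal (a * (\<kappa> - \<rho>) / \<kappa> * (norm (gradient envelope x))\<^sup>2)
      \<le> ennreal (\<integral>w. R w \<partial>P) + ennreal (a * (\<kappa> - \<rho>) / \<kappa> * (norm (gradient envelope x))\<^sup>2)"
    by (rule add_right_mono)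
  also have "\<dots> = ennreal ((\<integral>w. R w \<partial>P) + a * (\<kappa> - \<rho>) / \<kappa> * (norm (gradient envelope x))\<^sup>2)"
    using R_nonneg a kappa_pos rho_less_kappa
    by (intro ennreal_plus[symmetric] Bochner_Integration.integral_nonneg) auto
  also have "\<dots> \<le> ennreal ((envelope x - m) + \<kappa> / 2 * L\<^sup>2 * a\<^sup>2)"
    using bound by (rule ennreal_leI)
  also have "\<dots> = ennreal (envelope x - m) + ennreal (\<kappa> / 2 * L\<^sup>2 * a\<^sup>2)"
    using envelope_ge[of x] kappa_pos by (intro ennreal_plus) auto
  finally show ?thesis .
qed

lemma iterate_in_X:
  "x0 \<in> X \<Longrightarrow> proj_subgrad_iterate X G \<alpha> x0 s t \<in> X"
  by (cases t) (auto intro: closest_point_in_set[OF closed_X X_nonempty])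

lemma step_measurable:
  "(\<lambda>(x, w). closest_point X (x - a *\<^sub>R G x w)) \<in> borel_measurable (restrict_space borel U \<Otimes>\<^sub>M P)"
proof -
  have [measurable]: "closest_point X \<in> borel_measurable borel"
    by (intro borel_measurable_continuous_onI continuous_on_closest_point convex_X closed_X X_nonempty)
  have [measurable]: "fst \<in> borel_measurable (restrict_space borel U \<Otimes>\<^sub>M P)"
    using measurable_fst[of "restrict_space borel U" P]
    by (rule measurable_compose) (rule measurable_restrict_space1, simp)
  note G_measurable[measurable]
  have "(\<lambda>u. closest_point X (fst u - a *\<^sub>R case_prod G u))
      \<in> borel_measurable (restrict_space borel U \<Otimes>\<^sub>M P)"
    by measurable
  then show ?thesis by (simp add: split_beta')
qed

text \<open>The iterate after \<open>t\<close> steps is a function of the first \<open>t\<close> samples alone, which is what its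
  independence of the next sample rests on. The codomain is the restriction of the Borel space to
  \<open>U\<close> because \<open>G\<close> is jointly measurable only there.\<close>
lemma iterate_measurable:
  assumes x0: "x0 \<in> X" and "{..<t} \<subseteq> I"
  shows "(\<lambda>s. proj_subgrad_iterate X G \<alpha> x0 s t) \<in> measurable (PiM I (\<lambda>_. P)) (restrict_space borel U)"
proof (rule measurable_restrict_space2)
  show "(\<lambda>s. proj_subgrad_iterate X G \<alpha> x0 s t) \<in> borel_measurable (PiM I (\<lambda>_. P))"
    using assms(2)
  proof (induction t)
    case 0
    show ?case unfolding proj_subgrad_iterate.simps by (rule borel_measurable_const)
  next
    case (Suc t)
    let ?it = "\<lambda>s. proj_subgrad_iterate X G \<alpha> x0 s t"
    have "?it \<in> measurable (PiM I (\<lambda>_. P)) (restrict_space borel U)"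
    proof (rule measurable_restrict_space2)
      have "{..<t} \<subseteq> I" using Suc.prems by auto
      then show "?it \<in> borel_measurable (PiM I (\<lambda>_. P))" by (rule Suc.IH)
    qed (intro funcsetI subsetD[OF X_subset_U] iterate_in_X x0)
    moreover have "(\<lambda>s. s t) \<in> measurable (PiM I (\<lambda>_. P)) P"
      using Suc.prems by (intro measurable_component_singleton) auto
    ultimately have "(\<lambda>s. (?it s, s t)) \<in> measurable (PiM I (\<lambda>_. P)) (restrict_space borel U \<Otimes>\<^sub>M P)"
      by (rule measurable_Pair)
    from measurable_compose[OF this step_measurable[of "\<alpha> t"]] show ?case
      by (simp only: prod.case proj_subgrad_iterate.simps)
  qed
qed (intro funcsetI subsetD[OF X_subset_U] iterate_in_X x0)

end

section \<open>The stochastic projected subgradient iteration\<close>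

locale stochastic_projected_subgradient =
  stochastic_subgradient_oracle X g \<rho> \<kappa> m P U G L + prob_space M
  for X :: "'a::euclidean_space set" and g \<rho> \<kappa> m and P :: "'w measure" and U G L
    and M :: "'m measure" +
  fixes T :: nat and \<xi> :: "nat \<Rightarrow> 'm \<Rightarrow> 'w" and \<alpha> :: "nat \<Rightarrow> real" and x0 :: 'a
  assumes iid: "iid_samples M P T \<xi>" and x0_in_X: "x0 \<in> X"
    and stepsize_pos: "\<And>t. 0 < \<alpha> t"
begin

definition iterate :: "nat \<Rightarrow> 'm \<Rightarrow> 'a" where
  "iterate t w = proj_subgrad_iterate X G \<alpha> x0 (\<lambda>i. \<xi> i w) t"

lemma sample_measurable: "t \<le> T \<Longrightarrow> random_variable P (\<xi> t)"
  using iid unfolding iid_samples_def indep_vars_def by auto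

lemma sample_law: "t \<le> T \<Longrightarrow> distr M P (\<xi> t) = P"
  using iid unfolding iid_samples_def by auto

lemma iterate_measurable_samples:
  assumes "t \<le> T" shows "iterate t \<in> measurable M (restrict_space borel U)"
proof -
  have "(\<lambda>w. \<lambda>i\<in>{..<t}. \<xi> i w) \<in> measurable M (PiM {..<t} (\<lambda>_. P))"
    using assms by (intro measurable_restrict sample_measurable) auto
  from measurable_compose[OF this iterate_measurable[OF x0_in_X order_refl]]
  show ?thesis
    unfolding iterate_def by (simp cong: proj_subgrad_iterate_cong)
qed

lemma iterate_random_variable:
  assumes "t \<le> T" shows "random_variable borel (iterate t)"
  using iterate_measurable_samples[OF assms]
  by (rule measurable_compose) (rule measurable_restrict_space1, simp)

text \<open>The current iterate and the fresh sample have different value types, so independence is used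
  for the two blocks of samples \<open>{..<t}\<close> and \<open>{t}\<close> that determine them.\<close>
lemma nn_integral_iterate_sample:
  assumes t: "t \<le> T" and f: "f \<in> borel_measurable (restrict_space borel U \<Otimes>\<^sub>M P)"
  shows "(\<integral>\<^sup>+w. f (iterate t w, \<xi> t w) \<partial>M) = (\<integral>\<^sup>+w. (\<integral>\<^sup>+z. f (iterate t w, z) \<partial>P) \<partial>M)"
proof -
  let ?S = "PiM {..<t} (\<lambda>_. P)" and ?N = "PiM {t} (\<lambda>_. P)"
  let ?past = "\<lambda>w. \<lambda>i\<in>{..<t}. \<xi> i w" and ?now = "\<lambda>w. \<lambda>i\<in>{t}. \<xi> i w"
  let ?it = "\<lambda>s. proj_subgrad_iterate X G \<alpha> x0 s t"
  have indep: "indep_var ?S ?past ?N ?now"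
    using iid t unfolding iid_samples_def by (intro indep_var_restrict[of _ _ "{0..T}"]) auto
  have it: "?it (?past w) = iterate t w" for w
    unfolding iterate_def by (intro proj_subgrad_iterate_cong) simp
  have "(\<lambda>u. ?it (fst u)) \<in> measurable (?S \<Otimes>\<^sub>M ?N) (restrict_space borel U)"
    using measurable_compose[OF measurable_fst iterate_measurable[OF x0_in_X order_refl]] .
  moreover have "(\<lambda>u. snd u t) \<in> measurable (?S \<Otimes>\<^sub>M ?N) P"
    using measurable_compose[OF measurable_snd measurable_component_singleton[of t "{t}" "\<lambda>_. P"]]
    by simp
  ultimately have "(\<lambda>u. (?it (fst u), snd u t)) \<in> measurable (?S \<Otimes>\<^sub>M ?N) (restrict_space borel U \<Otimes>\<^sub>M P)"
    by (rule measurable_Pair)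
  from measurable_compose[OF this f]
  have "(\<integral>\<^sup>+w. f (iterate t w, \<xi> t w) \<partial>M) = (\<integral>\<^sup>+w. (\<integral>\<^sup>+w'. f (iterate t w, \<xi> t w') \<partial>M) \<partial>M)"
    using nn_integral_indep_pair[OF indep, of "\<lambda>u. f (?it (fst u), snd u t)"] by (simp add: it)
  also have "\<dots> = (\<integral>\<^sup>+w. (\<integral>\<^sup>+z. f (iterate t w, z) \<partial>distr M P (\<xi> t)) \<partial>M)"
    using measurable_space[OF iterate_measurable_samples[OF t]] f sample_measurable[OF t]
    by (intro nn_integral_cong nn_integral_distr[symmetric] measurable_Pair2[OF f]) auto
  finally show ?thesis using sample_law[OF t] by simp
qed

abbreviation sq_gradient :: "'a \<Rightarrow> real" where
  "sq_gradient x \<equiv> (norm (gradient envelope x))\<^sup>2"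

lemma sq_gradient_measurable: "sq_gradient \<in> borel_measurable borel"
  unfolding gradient_envelope
  by (intro borel_measurable_continuous_onI continuous_intros continuous_prox)

text \<open>The descent inequality integrated over the law of the current iterate.\<close>
lemma expected_descent_of_iterates:
  assumes t: "t \<le> T"
  shows "(\<integral>\<^sup>+w. ennreal (envelope (iterate (Suc t) w) - m) \<partial>M)
      + (\<integral>\<^sup>+w. ennreal (\<alpha> t * (\<kappa> - \<rho>) / \<kappa> * sq_gradient (iterate t w)) \<partial>M)
      \<le> (\<integral>\<^sup>+w. ennreal (envelope (iterate t w) - m) \<partial>M) + ennreal (\<kappa> / 2 * L\<^sup>2 * (\<alpha> t)\<^sup>2)"
proof -
  let ?next = "\<lambda>(x, z). ennreal (envelope (closest_point X (x - \<alpha> t *\<^sub>R G x z)) - m)"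
  have env[measurable]: "envelope \<in> borel_measurable borel"
    by (intro borel_measurable_continuous_onI continuous_envelope)
  note [measurable] = iterate_random_variable[OF t] sq_gradient_measurable
  have next_meas: "?next \<in> borel_measurable (restrict_space borel U \<Otimes>\<^sub>M P)"
  proof -
    have "(\<lambda>x. ennreal (envelope x - m)) \<in> borel_measurable borel" by measurable
    from measurable_compose[OF step_measurable[of "\<alpha> t"] this]
    show ?thesis by (simp add: split_beta')
  qed
  have meas: "(\<lambda>w. \<integral>\<^sup>+z. ?next (iterate t w, z) \<partial>P) \<in> borel_measurable M"
    using iterate_measurable_samples[OF t] sample.borel_measurable_nn_integral_fst[OF next_meas]
    by (rule measurable_compose)
  have "(\<integral>\<^sup>+w. ennreal (envelope (iterate (Suc t) w) - m) \<partial>M) = (\<integral>\<^sup>+w. ?next (iterate t w, \<xi> t w) \<partial>M)"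
    by (simp add: iterate_def)
  also have "\<dots> = (\<integral>\<^sup>+w. (\<integral>\<^sup>+z. ?next (iterate t w, z) \<partial>P) \<partial>M)"
    using nn_integral_iterate_sample[OF t next_meas] .
  finally have "(\<integral>\<^sup>+w. ennreal (envelope (iterate (Suc t) w) - m) \<partial>M)
      + (\<integral>\<^sup>+w. ennreal (\<alpha> t * (\<kappa> - \<rho>) / \<kappa> * sq_gradient (iterate t w)) \<partial>M)
      = (\<integral>\<^sup>+w. (\<integral>\<^sup>+z. ?next (iterate t w, z) \<partial>P)
            + ennreal (\<alpha> t * (\<kappa> - \<rho>) / \<kappa> * sq_gradient (iterate t w)) \<partial>M)"
    using meas by (simp only:) (intro nn_integral_add[symmetric], auto)
  also have "\<dots> \<le> (\<integral>\<^sup>+w. ennreal (envelope (iterate t w) - m) + ennreal (\<kappa> / 2 * L\<^sup>2 * (\<alpha> t)\<^sup>2) \<partial>M)"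
    using expected_descent[OF iterate_in_X[OF x0_in_X]] stepsize_pos[of t]
    by (intro nn_integral_mono) (auto simp: iterate_def)
  also have "\<dots> = (\<integral>\<^sup>+w. ennreal (envelope (iterate t w) - m) \<partial>M) + ennreal (\<kappa> / 2 * L\<^sup>2 * (\<alpha> t)\<^sup>2)"
    by (subst nn_integral_add) (auto simp: emeasure_space_1)
  finally show ?thesis .
qed

lemma envelope_descent_telescoped:
  "n \<le> Suc T \<Longrightarrow>
    (\<Sum>t<n. \<integral>\<^sup>+w. ennreal (\<alpha> t * (\<kappa> - \<rho>) / \<kappa> * sq_gradient (iterate t w)) \<partial>M)
      + (\<integral>\<^sup>+w. ennreal (envelope (iterate n w) - m) \<partial>M)
    \<le> ennreal (envelope x0 - m) + (\<Sum>t<n. ennreal (\<kappa> / 2 * L\<^sup>2 * (\<alpha> t)\<^sup>2))"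
proof (induction n)
  case 0
  then show ?case by (simp add: iterate_def emeasure_space_1)
next
  case (Suc n)
  let ?D = "\<lambda>t. \<integral>\<^sup>+w. ennreal (\<alpha> t * (\<kappa> - \<rho>) / \<kappa> * sq_gradient (iterate t w)) \<partial>M"
  let ?V = "\<lambda>t. \<integral>\<^sup>+w. ennreal (envelope (iterate t w) - m) \<partial>M"
  let ?c = "\<lambda>t. ennreal (\<kappa> / 2 * L\<^sup>2 * (\<alpha> t)\<^sup>2)"
  have "(\<Sum>t<Suc n. ?D t) + ?V (Suc n) = (\<Sum>t<n. ?D t) + (?V (Suc n) + ?D n)"
    by (simp add: ac_simps)
  also have "\<dots> \<le> (\<Sum>t<n. ?D t) + (?V n + ?c n)"
    using Suc.prems by (intro add_left_mono expected_descent_of_iterates) simp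
  also have "\<dots> \<le> (ennreal (envelope x0 - m) + (\<Sum>t<n. ?c t)) + ?c n"
    using Suc by (simp add: add.assoc[symmetric] add_right_mono)
  finally show ?case by (simp add: add.assoc)
qed

text \<open>The telescoped inequality bounds a sum of nonnegative integrals by a finite number. Therefore
  each summand is integrable, and the inequality can be read between real numbers.\<close>
lemma
  shows sq_gradient_integrable: "t \<le> T \<Longrightarrow> integrable M (\<lambda>w. sq_gradient (iterate t w))"
    and weighted_sum_bound: "(\<kappa> - \<rho>) / \<kappa> * (\<Sum>t=0..T. \<alpha> t * (\<integral>w. sq_gradient (iterate t w) \<partial>M))
      \<le> envelope x0 - m + \<kappa> / 2 * L\<^sup>2 * (\<Sum>t=0..T. (\<alpha> t)\<^sup>2)"
proof -
  let ?q = "\<lambda>t w. \<alpha> t * (\<kappa> - \<rho>) / \<kappa> * sq_gradient (iterate t w)"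
  have factor: "0 < \<alpha> t * (\<kappa> - \<rho>) / \<kappa>" for t
    using stepsize_pos[of t] kappa_pos rho_less_kappa by simp
  have nonneg: "0 \<le> ?q t w" for t w using factor[of t] by (intro mult_nonneg_nonneg) auto
  have set: "{..<Suc T} = {0..T}" by auto
  have "(\<Sum>t=0..T. \<integral>\<^sup>+w. ennreal (?q t w) \<partial>M)
      \<le> (\<Sum>t<Suc T. \<integral>\<^sup>+w. ennreal (?q t w) \<partial>M) + (\<integral>\<^sup>+w. ennreal (envelope (iterate (Suc T) w) - m) \<partial>M)"
    unfolding set by simp
  also have "\<dots> \<le> ennreal (envelope x0 - m) + (\<Sum>t<Suc T. ennreal (\<kappa> / 2 * L\<^sup>2 * (\<alpha> t)\<^sup>2))"
    by (rule envelope_descent_telescoped) simp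
  also have "\<dots> = ennreal (envelope x0 - m + \<kappa> / 2 * L\<^sup>2 * (\<Sum>t=0..T. (\<alpha> t)\<^sup>2))"
    unfolding set sum_distrib_left using envelope_ge[of x0] kappa_pos
    by (subst ennreal_plus) (auto simp: sum_ennreal intro!: sum_nonneg)
  finally have total: "(\<Sum>t=0..T. \<integral>\<^sup>+w. ennreal (?q t w) \<partial>M)
      \<le> ennreal (envelope x0 - m + \<kappa> / 2 * L\<^sup>2 * (\<Sum>t=0..T. (\<alpha> t)\<^sup>2))" .
  have q_int: "integrable M (?q t)" if "t \<le> T" for t
  proof (rule integrableI_nonneg)
    have "(\<integral>\<^sup>+w. ennreal (?q t w) \<partial>M) \<le> (\<Sum>t=0..T. \<integral>\<^sup>+w. ennreal (?q t w) \<partial>M)"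
      using that by (intro member_le_sum) auto
    also note total
    finally show "(\<integral>\<^sup>+w. ennreal (?q t w) \<partial>M) < \<infinity>" by (rule le_less_trans) simp
    show "?q t \<in> borel_measurable M"
      using measurable_compose[OF iterate_random_variable[OF that] sq_gradient_measurable] by simp
  qed (intro AE_I2 nonneg)
  show "integrable M (\<lambda>w. sq_gradient (iterate t w))" if "t \<le> T" for t
    using q_int[OF that] factor[of t] by (subst (asm) integrable_mult_left_iff) auto
  have "(\<Sum>t=0..T. \<integral>\<^sup>+w. ennreal (?q t w) \<partial>M) = (\<Sum>t=0..T. ennreal (\<integral>w. ?q t w \<partial>M))"
    by (intro sum.cong refl nn_integral_eq_integral q_int AE_I2 nonneg) simp
  also have "\<dots> = ennreal (\<Sum>t=0..T. \<integral>w. ?q t w \<partial>M)"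
    by (intro sum_ennreal Bochner_Integration.integral_nonneg nonneg)
  finally have "ennreal (\<Sum>t=0..T. \<integral>w. ?q t w \<partial>M)
      \<le> ennreal (envelope x0 - m + \<kappa> / 2 * L\<^sup>2 * (\<Sum>t=0..T. (\<alpha> t)\<^sup>2))"
    using total by simp
  moreover have "0 \<le> envelope x0 - m + \<kappa> / 2 * L\<^sup>2 * (\<Sum>t=0..T. (\<alpha> t)\<^sup>2)"
    using envelope_ge[of x0] kappa_pos by (simp add: sum_nonneg)
  ultimately have "(\<Sum>t=0..T. \<integral>w. ?q t w \<partial>M) \<le> envelope x0 - m + \<kappa> / 2 * L\<^sup>2 * (\<Sum>t=0..T. (\<alpha> t)\<^sup>2)"
    by (simp add: ennreal_le_iff)
  moreover have "(\<Sum>t=0..T. \<integral>w. ?q t w \<partial>M)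
      = (\<kappa> - \<rho>) / \<kappa> * (\<Sum>t=0..T. \<alpha> t * (\<integral>w. sq_gradient (iterate t w) \<partial>M))"
    unfolding sum_distrib_left by (intro sum.cong refl) simp
  ultimately show "(\<kappa> - \<rho>) / \<kappa> * (\<Sum>t=0..T. \<alpha> t * (\<integral>w. sq_gradient (iterate t w) \<partial>M))
      \<le> envelope x0 - m + \<kappa> / 2 * L\<^sup>2 * (\<Sum>t=0..T. (\<alpha> t)\<^sup>2)" by simp
qed

text \<open>Sampling the index with probabilities proportional to the stepsizes turns the weighted sum
  into an expectation.\<close>
theorem expected_sq_gradient_at_output:
  assumes out: "output_index M P T \<alpha> \<xi> \<tau>"
  shows "integrable M (\<lambda>w. sq_gradient (iterate (\<tau> w) w))"
    and "(\<integral>w. sq_gradient (iterate (\<tau> w) w) \<partial>M)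
      \<le> \<kappa> / (\<kappa> - \<rho>) * ((envelope x0 - m + \<kappa> / 2 * L\<^sup>2 * (\<Sum>t=0..T. (\<alpha> t)\<^sup>2)) / (\<Sum>t=0..T. \<alpha> t))"
proof -
  let ?F = "\<lambda>t s. sq_gradient (proj_subgrad_iterate X G \<alpha> x0 s t)"
  have F_eq: "?F t (\<lambda>i\<in>{0..T}. \<xi> i w) = sq_gradient (iterate t w)" if "t \<le> T" for t w
  proof -
    have "proj_subgrad_iterate X G \<alpha> x0 (\<lambda>i\<in>{0..T}. \<xi> i w) t = iterate t w"
      unfolding iterate_def using that by (intro proj_subgrad_iterate_cong) simp
    then show ?thesis by simp
  qed
  have F_meas: "?F t \<in> borel_measurable (PiM {0..T} (\<lambda>_. P))" if "t \<le> T" for t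
  proof -
    have "(\<lambda>s. proj_subgrad_iterate X G \<alpha> x0 s t) \<in> measurable (PiM {0..T} (\<lambda>_. P)) (restrict_space borel U)"
      using that by (intro iterate_measurable x0_in_X) auto
    then show ?thesis
      by (rule measurable_compose) (rule measurable_restrict_space1, rule sq_gradient_measurable)
  qed
  have F_int: "integrable M (\<lambda>w. ?F t (\<lambda>i\<in>{0..T}. \<xi> i w))" if "t \<le> T" for t
    unfolding F_eq[OF that] by (rule sq_gradient_integrable[OF that])
  note idx = output_index_expectation[where F = ?F, OF out sample_measurable F_meas F_int]
  have tau: "\<tau> w \<le> T" if "w \<in> space M" for w
    using out measurable_space[of \<tau> M "count_space {0..T}" w] that unfolding output_index_def by auto
  have cong: "?F (\<tau> w) (\<lambda>i\<in>{0..T}. \<xi> i w) = sq_gradient (iterate (\<tau> w) w)" if "w \<in> space M" for w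
    by (rule F_eq[OF tau[OF that]])
  show "integrable M (\<lambda>w. sq_gradient (iterate (\<tau> w) w))"
  proof (subst Bochner_Integration.integrable_cong[OF refl cong[symmetric]])
    show "integrable M (\<lambda>w. ?F (\<tau> w) (\<lambda>i\<in>{0..T}. \<xi> i w))" by (rule idx(1))
  qed
  have "(\<integral>w. sq_gradient (iterate (\<tau> w) w) \<partial>M) = (\<integral>w. ?F (\<tau> w) (\<lambda>i\<in>{0..T}. \<xi> i w) \<partial>M)"
    by (rule Bochner_Integration.integral_cong[OF refl cong[symmetric]])
  also have "\<dots> = (\<Sum>t=0..T. \<alpha> t * (\<integral>w. ?F t (\<lambda>i\<in>{0..T}. \<xi> i w) \<partial>M)) / (\<Sum>t=0..T. \<alpha> t)"
    by (rule idx(2))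
  also have "\<dots> = (\<Sum>t=0..T. \<alpha> t * (\<integral>w. sq_gradient (iterate t w) \<partial>M)) / (\<Sum>t=0..T. \<alpha> t)"
    by (intro arg_cong2[of _ _ _ _ "(/)"] sum.cong refl) (simp add: F_eq)
  also have "\<dots> \<le> (\<kappa> / (\<kappa> - \<rho>) * (envelope x0 - m + \<kappa> / 2 * L\<^sup>2 * (\<Sum>t=0..T. (\<alpha> t)\<^sup>2))) / (\<Sum>t=0..T. \<alpha> t)"
  proof (rule divide_right_mono)
    show "(\<Sum>t=0..T. \<alpha> t * (\<integral>w. sq_gradient (iterate t w) \<partial>M))
        \<le> \<kappa> / (\<kappa> - \<rho>) * (envelope x0 - m + \<kappa> / 2 * L\<^sup>2 * (\<Sum>t=0..T. (\<alpha> t)\<^sup>2))"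
      using mult_left_mono[OF weighted_sum_bound, of "\<kappa> / (\<kappa> - \<rho>)"] kappa_pos rho_less_kappa
      by simp
    show "0 \<le> (\<Sum>t=0..T. \<alpha> t)" using stepsize_pos by (intro sum_nonneg) (simp add: less_imp_le)
  qed
  finally show "(\<integral>w. sq_gradient (iterate (\<tau> w) w) \<partial>M)
      \<le> \<kappa> / (\<kappa> - \<rho>) * ((envelope x0 - m + \<kappa> / 2 * L\<^sup>2 * (\<Sum>t=0..T. (\<alpha> t)\<^sup>2)) / (\<Sum>t=0..T. \<alpha> t))"
    by simp
qed

end

section \<open>The convergence rate\<close>

theorem corollary2p2:
  fixes X U :: "'a::euclidean_space set"
    and g :: "'a \<Rightarrow> real" and \<phi> :: "'a \<Rightarrow> ereal"
    and \<rho> L \<gamma> :: real and T :: nat and x0 :: 'a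
    and P :: "'w measure" and G :: "'a \<Rightarrow> 'w \<Rightarrow> 'a"
    and M :: "'m measure" and \<xi> :: "nat \<Rightarrow> 'm \<Rightarrow> 'w" and \<tau> :: "'m \<Rightarrow> nat"
    and \<alpha> :: "nat \<Rightarrow> real"
  assumes "closed X" and "convex X"
    and "\<rho> > 0" and "weakly_convex \<rho> g"
    and phi: "\<phi> = (\<lambda>x. ereal (g x) + convex_indicator X x)"
    and min_exists: "\<exists>z. \<forall>y. \<phi> z \<le> \<phi> y"
    and "prob_space P"
    and "prob_space M"
    and A1: "iid_samples M P T \<xi>"
    and A2: "open U" "X \<subseteq> U"
      "case_prod G \<in> borel_measurable (restrict_space borel U \<Otimes>\<^sub>M P)"
      "\<And>x. x \<in> U \<Longrightarrow> integrable P (G x)"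
      "\<And>x. x \<in> U \<Longrightarrow> (\<integral>w. G x w \<partial>P) \<in> subdifferential g x"
    and A3: "L \<ge> 0"
      "\<And>x. x \<in> X \<Longrightarrow> (\<integral>\<^sup>+w. ennreal ((norm (G x w))\<^sup>2) \<partial>P) \<le> ennreal (L\<^sup>2)"
    and "x0 \<in> X" and "T > 0" and "\<gamma> > 0"
    and stepsize: "\<alpha> = (\<lambda>t. \<gamma> / sqrt (real T + 1))"
    and index: "output_index M P T \<alpha> \<xi> \<tau>"
  defines "sq_grad \<equiv> \<lambda>w. (norm (gradient (moreau_envelope (1 / (2 * \<rho>)) \<phi>)
              (proj_subgrad_iterate X G \<alpha> x0 (\<lambda>t. \<xi> t w) (\<tau> w))))\<^sup>2"
  shows "integrable M sq_grad \<and>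
    (\<integral>w. sq_grad w \<partial>M)
      \<le> 2 * (((moreau_envelope (1 / (2 * \<rho>)) \<phi> x0 - min_value \<phi>) + \<rho> * L\<^sup>2 * \<gamma>\<^sup>2)
              / (\<gamma> * sqrt (real T + 1)))"
proof -
  obtain z where z: "\<And>y. \<phi> z \<le> \<phi> y" using min_exists by blast
  \<comment> \<open>\<open>x0\<close> is feasible, so the minimum is finite and a minimizer must be feasible.\<close>
  have zX: "z \<in> X"
    using z[of x0] \<open>x0 \<in> X\<close> by (auto simp: phi convex_indicator_def split: if_splits)
  have min_phi: "min_value \<phi> = g z"
    using zX by (intro min_value_eq[where p = z] z) (simp add: phi convex_indicator_def)
  have g_min: "g z \<le> g y" if "y \<in> X" for y
    using z[of y] zX that by (simp add: phi convex_indicator_def)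
  interpret P: prob_space P by fact
  interpret M: prob_space M by fact
  \<comment> \<open>\<open>\<kappa> = 2 * \<rho>\<close> corresponds to \<open>\<lambda> = 1 / (2 * \<rho>)\<close> and gives \<open>\<kappa> / (\<kappa> - \<rho>) = 2\<close> and \<open>\<kappa> / 2 = \<rho>\<close>.\<close>
  interpret stochastic_projected_subgradient X g \<rho> "2 * \<rho>" "g z" P U G L M T \<xi> \<alpha> x0
    by unfold_locales (use assms g_min in auto)
  have env: "moreau_envelope (1 / (2 * \<rho>)) \<phi> = envelope"
    by (rule moreau_envelope_eq[OF phi])
  have sq: "sq_grad = (\<lambda>w. sq_gradient (iterate (\<tau> w) w))"
    unfolding sq_grad_def env iterate_def ..
  have "(\<Sum>t=0..T. \<alpha> t) = \<gamma> * ((real T + 1) / sqrt (real T + 1))"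
    by (simp add: stepsize)
  also have "(real T + 1) / sqrt (real T + 1) = sqrt (real T + 1)"
    by (rule real_div_sqrt) simp
  finally have sum_steps: "(\<Sum>t=0..T. \<alpha> t) = \<gamma> * sqrt (real T + 1)" .
  have "(\<Sum>t=0..T. (\<alpha> t)\<^sup>2) = (real T + 1) * (\<gamma>\<^sup>2 / (real T + 1))"
    by (simp add: stepsize power_divide add.commute)
  also have "\<dots> = \<gamma>\<^sup>2"
    unfolding times_divide_eq_right
    by (rule nonzero_mult_div_cancel_left) (use of_nat_0_le_iff[of T] in linarith)
  finally have sum_sq_steps: "(\<Sum>t=0..T. (\<alpha> t)\<^sup>2) = \<gamma>\<^sup>2" .
  have factors: "2 * \<rho> / (2 * \<rho> - \<rho>) = 2" "2 * \<rho> / 2 * L\<^sup>2 * \<gamma>\<^sup>2 = \<rho> * L\<^sup>2 * \<gamma>\<^sup>2"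
    using \<open>\<rho> > 0\<close> by (auto simp: field_simps)
  show ?thesis
    using expected_sq_gradient_at_output[OF index]
    unfolding sq env min_phi sum_steps sum_sq_steps factors by (rule conjI)
qed

end
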